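(* Let $G$ be a graph and let $H$ be an attachment set of $G$, with $h=|H|$. Then $$\eta(\mathfrak{a}(G,H))\le \begin{cases}\eta(G)+2 & \text{if } h \text{ is even},\\ \eta(G) & \text{if } h \text{ is odd}.\end{cases}$$
   Context: All graphs are finite and simple (not necessarily connected). The nullity $\eta(G)$ of a graph $G$ is $\dim\ker A(G)$, where $A(G)$ is the (real) adjacency matrix of $G$. An attachment set of $G$ is a cyclic $h$-tuple $H=(v_1,\dots,v_h)$ of vertices of $G$ with $h\ge 2$, in which a vertex may occur more than once; $|H|=h$ denotes the length of the tuple (counting repetitions). The altan $\mathfrak{a}(G,H)$ is the pair $(G',H')$, where $G'$ is the graph with vertex set $V(G')=V(G)\sqcup\{x_1,\dots,x_h\}\sqcup\{y_1,\dots,y_h\}$ (disjoint union, all $x_i$, $y_i$ being new distinct vertices) and edge set $E(G')=E(G)\sqcup\{v_ix_i,\,x_iy_i : 1\le i\le h\}\sqcup\{y_ix_{i+1} : 1\le i<h\}\sqcup\{y_hx_1\}$, and $H'=(y_1,\dots,y_h)$ is the induced attachment set. The nullity of a pair means the nullity of its graph, so $\eta(\mathfrak{a}(G,H))=\eta(G')$. *)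

theory Defs
  imports
    "Graph_Theory.Pair_Digraph"
    "Jordan_Normal_Form.Matrix_Kernel"
begin

text \<open>
  A finite simple graph is a \<^const>\<open>pair_graph\<close>: finitely many vertices, a symmetric and
  loop-free set of arcs, each undirected edge being represented by its two orientations.
\<close>

definition vertex_enum :: "'a pair_pre_digraph \<Rightarrow> 'a list \<Rightarrow> bool" where
  "vertex_enum G vs \<longleftrightarrow> distinct vs \<and> set vs = pverts G"

definition adjacency_mat :: "'a pair_pre_digraph \<Rightarrow> 'a list \<Rightarrow> real mat" where
  "adjacency_mat G vs =
     mat (length vs) (length vs) (\<lambda>(i, j). if (vs ! i, vs ! j) \<in> parcs G then 1 else 0)"

text \<open>
  Matrices are indexed by numbers, so an enumeration of the vertices is chosen; the result
  does not depend on it, see \<open>nullity_eq\<close> below.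
\<close>

definition nullity :: "'a pair_pre_digraph \<Rightarrow> nat" where
  "nullity G = kernel_dim (adjacency_mat G (SOME vs. vertex_enum G vs))"

text \<open>
  A cyclic tuple is represented by a list starting at one of its entries; cyclicity only
  enters through the wrap-around edge of the altan.
\<close>

definition attachment_set :: "'a pair_pre_digraph \<Rightarrow> 'a list \<Rightarrow> bool" where
  "attachment_set G H \<longleftrightarrow> set H \<subseteq> pverts G \<and> 2 \<le> length H"

datatype 'a altan_vertex = Base 'a | X nat | Y nat

text \<open>
  Indices are shifted to start at 0, and \<open>Suc i mod h\<close> covers both the edges
  \<open>y_i x_{i+1}\<close> and the closing edge \<open>y_h x_1\<close>.
\<close>

definition altan_new_edges :: "'a list \<Rightarrow> 'a altan_vertex rel" where
  "altan_new_edges H =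
     {(Base (H ! i), X i) | i. i < length H}
   \<union> {(X i, Y i) | i. i < length H}
   \<union> {(Y i, X (Suc i mod length H)) | i. i < length H}"

definition altan ::
  "'a pair_pre_digraph \<Rightarrow> 'a list \<Rightarrow> 'a altan_vertex pair_pre_digraph \<times> 'a altan_vertex list" where
  "altan G H =
     (\<lparr> pverts = Base ` pverts G \<union> X ` {..<length H} \<union> Y ` {..<length H},
        parcs = map_prod Base Base ` parcs G \<union> altan_new_edges H \<union> (altan_new_edges H)\<inverse> \<rparr>,
      map Y [0..<length H])"

lemma vertex_enum_exists:
  assumes "pair_graph G"
  shows "\<exists>vs. vertex_enum G vs"
proof -
  interpret pair_graph G by fact
  show ?thesis
    using finite_distinct_list[OF pair_finite_verts] by (auto simp: vertex_enum_def)
qed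

lemma kernel_dim_adjacency_mat_cong:
  assumes vs: "vertex_enum G vs" and ws: "vertex_enum G ws"
  shows "kernel_dim (adjacency_mat G vs) = kernel_dim (adjacency_mat G ws)"
proof -
  define n where "n = length vs"
  have d: "distinct vs" "distinct ws" "set vs = set ws"
    using vs ws by (auto simp: vertex_enum_def)
  have lw: "length ws = n"
    using d by (metis distinct_card n_def)
  define P where "P = mat n n (\<lambda>(i, j). if vs ! i = ws ! j then 1 else 0 :: real)"
  define Q where "Q = mat n n (\<lambda>(i, j). if ws ! i = vs ! j then 1 else 0 :: real)"
  define f where "f i = (SOME j. j < n \<and> ws ! j = vs ! i)" for i
  define g where "g i = (SOME j. j < n \<and> vs ! j = ws ! i)" for i
  have f: "f i < n \<and> ws ! f i = vs ! i" if "i < n" for i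
  proof -
    have "vs ! i \<in> set ws" using that nth_mem[of i vs] by (simp only: n_def d(3))
    then have "\<exists>j. j < n \<and> ws ! j = vs ! i" by (simp only: in_set_conv_nth lw)
    then show ?thesis unfolding f_def by (rule someI_ex)
  qed
  have g: "g i < n \<and> vs ! g i = ws ! i" if "i < n" for i
  proof -
    have "ws ! i \<in> set vs" using that nth_mem[of i ws] by (simp only: lw d(3))
    then have "\<exists>j. j < n \<and> vs ! j = ws ! i" by (simp only: in_set_conv_nth n_def)
    then show ?thesis unfolding g_def by (rule someI_ex)
  qed
  have fe: "vs ! i = ws ! j \<longleftrightarrow> j = f i" if "i < n" "j < n" for i j
    using f[OF that(1)] that(2) nth_eq_iff_index_eq[OF d(2), of "f i" j] lw by auto
  have ge: "ws ! i = vs ! j \<longleftrightarrow> j = g i" if "i < n" "j < n" for i j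
    using g[OF that(1)] that(2) nth_eq_iff_index_eq[OF d(1), of "g i" j] n_def by auto
  have fe': "ws ! j = vs ! i \<longleftrightarrow> j = f i" if "i < n" "j < n" for i j
    using fe[OF that] by metis
  let ?A = "adjacency_mat G vs" and ?B = "adjacency_mat G ws"
  have cB: "?B \<in> carrier_mat n n" by (auto simp: adjacency_mat_def lw)
  have cA: "?A \<in> carrier_mat n n" by (auto simp: adjacency_mat_def n_def)
  have cP: "P \<in> carrier_mat n n" and cQ: "Q \<in> carrier_mat n n" by (auto simp: P_def Q_def)
  have mm: "(M * N) $$ (i, j) = (\<Sum>k\<in>{0..<n}. M $$ (i, k) * N $$ (k, j))"
    if "M \<in> carrier_mat n n" "N \<in> carrier_mat n n" "i < n" "j < n" for M N :: "real mat" and i j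
    using that by (auto simp: scalar_prod_def)
  have PQ: "P * Q = 1\<^sub>m n"
  proof (rule eq_matI)
    fix i j assume ij: "i < dim_row (1\<^sub>m n)" "j < dim_col (1\<^sub>m n)"
    then have ij': "i < n" "j < n" by auto
    have "(P * Q) $$ (i, j) = (\<Sum>k\<in>{0..<n}. P $$ (i, k) * Q $$ (k, j))"
      by (rule mm[OF cP cQ ij'])
    also have "\<dots> = (\<Sum>k\<in>{0..<n}. if k = f i then (if ws ! k = vs ! j then 1 else 0) else 0)"
      using ij' by (intro sum.cong refl) (simp add: P_def Q_def fe)
    also have "\<dots> = (if vs ! i = vs ! j then 1 else 0)" using f[of i] ij by (subst sum.delta) auto
    finally show "(P * Q) $$ (i, j) = 1\<^sub>m n $$ (i, j)"
      using ij d by (auto simp: n_def nth_eq_iff_index_eq)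
  qed (auto simp: P_def Q_def)
  have QP: "Q * P = 1\<^sub>m n"
  proof (rule eq_matI)
    fix i j assume ij: "i < dim_row (1\<^sub>m n)" "j < dim_col (1\<^sub>m n)"
    then have ij': "i < n" "j < n" by auto
    have "(Q * P) $$ (i, j) = (\<Sum>k\<in>{0..<n}. Q $$ (i, k) * P $$ (k, j))"
      by (rule mm[OF cQ cP ij'])
    also have "\<dots> = (\<Sum>k\<in>{0..<n}. if k = g i then (if vs ! k = ws ! j then 1 else 0) else 0)"
      using ij' by (intro sum.cong refl) (simp add: Q_def P_def ge)
    also have "\<dots> = (if ws ! i = ws ! j then 1 else 0)" using g[of i] ij by (subst sum.delta) auto
    finally show "(Q * P) $$ (i, j) = 1\<^sub>m n $$ (i, j)"
      using ij d lw by (auto simp: nth_eq_iff_index_eq)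
  qed (auto simp: P_def Q_def)
  have PB: "(P * ?B) $$ (i, j) = (if (vs ! i, ws ! j) \<in> parcs G then 1 else 0)"
    if "i < n" "j < n" for i j
  proof -
    have "(P * ?B) $$ (i, j) = (\<Sum>k\<in>{0..<n}. P $$ (i, k) * ?B $$ (k, j))"
      by (rule mm[OF cP cB that])
    also have "\<dots> =
        (\<Sum>k\<in>{0..<n}. if k = f i then (if (ws ! k, ws ! j) \<in> parcs G then 1 else 0) else 0)"
      using that by (intro sum.cong refl) (simp add: P_def adjacency_mat_def lw fe)
    also have "\<dots> = (if (vs ! i, ws ! j) \<in> parcs G then 1 else 0)"
      using f[OF that(1)] by (subst sum.delta) auto
    finally show ?thesis .
  qed
  have A: "?A = P * ?B * Q"
  proof (rule eq_matI)
    fix i j assume ij0: "i < dim_row (P * ?B * Q)" "j < dim_col (P * ?B * Q)"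
    then have ij: "i < n" "j < n" by (auto simp: P_def Q_def)
    have "(P * ?B * Q) $$ (i, j) = (\<Sum>k\<in>{0..<n}. (P * ?B) $$ (i, k) * Q $$ (k, j))"
      by (rule mm[OF mult_carrier_mat[OF cP cB] cQ ij])
    also have "\<dots> = (\<Sum>k\<in>{0..<n}. if k = f j then (if (vs ! i, ws ! k) \<in> parcs G then 1 else 0) else 0)"
      using ij by (intro sum.cong refl) (auto simp: PB Q_def fe')
    also have "\<dots> = ?A $$ (i, j)"
      using f[OF ij(2)] ij by (simp add: adjacency_mat_def n_def)
    finally show "?A $$ (i, j) = (P * ?B * Q) $$ (i, j)" by simp
  qed (auto simp: P_def Q_def adjacency_mat_def n_def)
  have "similar_mat_wit ?A ?B P Q"
    unfolding similar_mat_wit_def Let_def using cA cB PQ QP A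
    by (auto simp: P_def Q_def)
  then have "kernel.dim n ?A = kernel.dim n ?B" by (rule similar_mat_wit_kernel_dim[OF cA])
  then show ?thesis using cA cB by (simp add: kernel_dim_def carrier_matD)
qed

lemma nullity_eq:
  assumes "vertex_enum G vs"
  shows "nullity G = kernel_dim (adjacency_mat G vs)"
  unfolding nullity_def
  using assms by (intro kernel_dim_adjacency_mat_cong) (auto intro: someI)

lemma pair_graph_altan:
  assumes "pair_graph G" "attachment_set G H"
  shows "pair_graph (fst (altan G H))"
proof -
  interpret pair_graph G by fact
  have H: "H ! i \<in> pverts G" if "i < length H" for i
    using assms(2) that by (auto simp: attachment_set_def)
  have eq: "altan_new_edges H =
      (\<lambda>i. (Base (H ! i), X i)) ` {..<length H} \<union> (\<lambda>i. (X i, Y i)) ` {..<length H}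
      \<union> (\<lambda>i. (Y i, X (Suc i mod length H))) ` {..<length H}"
    by (auto simp: altan_new_edges_def)
  have fin: "finite (altan_new_edges H)" unfolding eq by simp
  have base: "(v, u) \<in> parcs G" if "(u, v) \<in> parcs G" for u v
    using that pair_sym_arcs by (auto simp: symmetric_def dest: symD)
  have new: "fst e \<in> pverts (fst (altan G H)) \<and> snd e \<in> pverts (fst (altan G H)) \<and> fst e \<noteq> snd e"
    if "e \<in> altan_new_edges H" for e
  proof -
    have "Suc i mod length H < length H" if "i < length H" for i
      using that by (intro mod_less_divisor) auto
    then show ?thesis using that H by (auto simp: altan_new_edges_def altan_def)
  qed
  have old: "fst e \<in> pverts (fst (altan G H)) \<and> snd e \<in> pverts (fst (altan G H)) \<and> fst e \<noteq> snd e"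
    if "e \<in> map_prod Base Base ` parcs G" for e
    using that by (auto simp: altan_def dest: in_arcsD1 in_arcsD2 no_loops')
  have all: "fst e \<in> pverts (fst (altan G H)) \<and> snd e \<in> pverts (fst (altan G H)) \<and> fst e \<noteq> snd e"
    if "e \<in> parcs (fst (altan G H))" for e
  proof -
    have "e \<in> map_prod Base Base ` parcs G \<or> e \<in> altan_new_edges H \<or> prod.swap e \<in> altan_new_edges H"
      using that by (auto simp: altan_def)
    then show ?thesis using new[of e] new[of "prod.swap e"] old[of e] by auto
  qed
  have sym: "sym (parcs (fst (altan G H)))"
    by (rule symI) (auto simp: altan_def dest: base intro: rev_image_eqI)
  show ?thesis
  proof
    show "finite (pverts (fst (altan G H)))" by (simp add: altan_def pair_finite_verts)
    show "finite (parcs (fst (altan G H)))" by (simp add: altan_def fin pair_finite_arcs)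
    show "symmetric (with_proj (fst (altan G H)))"
      using sym by (simp add: symmetric_def)
  qed (use all in auto)
qed

lemma attachment_set_altan:
  assumes "attachment_set G H"
  shows "attachment_set (fst (altan G H)) (snd (altan G H))"
  using assms by (auto simp: attachment_set_def altan_def)

end

theory Submission
  imports Defs "Jordan_Normal_Form.DL_Rank"
begin

text \<open>
  A vector in the kernel of an adjacency matrix is a function \<open>f\<close> on the vertices whose values
  sum to zero over the neighbourhood of every vertex (\<open>null_function\<close>). On the altan of \<open>G\<close>
  this condition has three parts, with indices modulo \<open>h\<close>:
  \<^item> at \<open>y\<^sub>i\<close> it says \<open>f x\<^sub>i + f x\<^sub>i\<^sub>+\<^sub>1 = 0\<close>, so the values on the \<open>x\<^sub>i\<close> alternate
    in sign around a cycle of length \<open>h\<close>;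
  \<^item> at \<open>x\<^sub>i\<^sub>+\<^sub>1\<close> it says \<open>f v\<^sub>i\<^sub>+\<^sub>1 + f y\<^sub>i\<^sub>+\<^sub>1 + f y\<^sub>i = 0\<close>;
  \<^item> at a vertex \<open>v\<close> of \<open>G\<close> it adds to the condition in \<open>G\<close> the values of the attached \<open>x\<^sub>i\<close>.

  An alternating cyclic sequence vanishes if its length is odd, or if its initial term is zero
  (\<open>alternating_cycle_eq_0\<close>). Let \<open>R\<close> be empty for odd \<open>h\<close> and consist of the initial \<open>x\<close>- and
  \<open>y\<close>-vertex for even \<open>h\<close>, and suppose that \<open>f\<close> vanishes on \<open>R\<close>. Then all \<open>f x\<^sub>i\<close> are zero,
  hence \<open>f\<close> restricts to a null function on \<open>G\<close>. If moreover this restriction is zero, then the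
  \<open>f y\<^sub>i\<close> alternate as well and \<open>f\<close> is zero altogether. So the null functions that satisfy the
  \<open>card R\<close> linear constraints embed into those of \<open>G\<close>, which bounds the nullity by
  \<open>nullity G + card R\<close> (\<open>nullity_le_add_card\<close>); this is rank-nullity, in the form of
  \<open>kernel_dim_le_add_constraints\<close>.
\<close>

section \<open>Comparing kernels along linear maps\<close>

lemma (in linear_map) dim_le_dim_plus_dim_ker:
  assumes V: "V.fin_dim" and W: "W.fin_dim"
  shows "V.dim \<le> W.dim + vectorspace.dim K (V.vs kerT)"
proof -
  have im: "subspace K imT W" by (rule imT_is_subspace)
  interpret im: vectorspace K "W.vs imT" by (rule W.subspace_is_vs[OF im])
  have "linear_map K V (W.vs imT) T"
    by unfold_locales (auto simp: module_hom_def im_def)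
  then have "vectorspace.fin_dim K (W.vs imT)"
    by (rule linear_map.surj_fin_dim[OF _ V]) (simp add: im_def)
  then have "im.dim \<le> W.dim" by (rule W.subspace_dim[OF im W])
  with rank_nullity[OF V] show ?thesis by simp
qed

lemma (in kernel) fin_dim_kernel: "Ker.fin_dim"
  using kernel_basis_exists[OF A] unfolding Ker.fin_dim_def Ker.basis_def by auto

lemma mat_kernel_append_rows:
  assumes A: "A \<in> carrier_mat nr nc" and T: "T \<in> carrier_mat k nc"
  shows "mat_kernel (A @\<^sub>r T) = {v \<in> mat_kernel A. T *\<^sub>v v = 0\<^sub>v k}"
proof -
  have "(A @\<^sub>r T) *\<^sub>v v = 0\<^sub>v (nr + k) \<longleftrightarrow> A *\<^sub>v v = 0\<^sub>v nr \<and> T *\<^sub>v v = 0\<^sub>v k"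
    if v: "v \<in> carrier_vec nc" for v
  proof -
    have "(0\<^sub>v (nr + k) :: 'a vec) = 0\<^sub>v nr @\<^sub>v 0\<^sub>v k" by auto
    moreover have "A *\<^sub>v v \<in> carrier_vec nr" using A v by simp
    ultimately show ?thesis
      using append_vec_eq[of "A *\<^sub>v v" nr "0\<^sub>v nr" "T *\<^sub>v v" "0\<^sub>v k"]
      by (simp add: mat_mult_append[OF A T v])
  qed
  then show ?thesis
    unfolding mat_kernel[OF carrier_append_rows[OF A T]] mat_kernel[OF A] by auto
qed

text \<open>
  Rank-nullity for the restriction of \<open>T\<close> to the kernel of \<open>A\<close>: stacking \<open>T\<close> below \<open>A\<close>
  expresses the kernel of this restriction as a matrix kernel again.
\<close>

lemma kernel_dim_le_target_plus_common_kernel: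
  fixes A :: "'a :: field mat"
  assumes A: "A \<in> carrier_mat nr nc" and B: "B \<in> carrier_mat mr m"
    and T: "T \<in> carrier_mat m nc"
    and maps: "\<And>v. v \<in> mat_kernel A \<Longrightarrow> T *\<^sub>v v \<in> mat_kernel B"
  shows "kernel_dim A \<le> kernel_dim B + kernel_dim (A @\<^sub>r T)"
proof -
  have AT: "A @\<^sub>r T \<in> carrier_mat (nr + m) nc" using A T by simp
  interpret A: kernel nr nc A by unfold_locales (rule A)
  interpret B: kernel mr m B by unfold_locales (rule B)
  interpret AT: kernel "nr + m" nc "A @\<^sub>r T" by unfold_locales (rule AT)
  have carr: "v \<in> carrier_vec nc" if "v \<in> mat_kernel A" for v
    using that mat_kernelD[OF A] by blast
  interpret T: linear_map class_ring A.VK B.VK "\<lambda>v. T *\<^sub>v v"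
  proof (intro linear_map.intro mod_hom.intro mod_hom_axioms.intro)
    show "(\<lambda>v. T *\<^sub>v v) \<in> module_hom class_ring A.VK B.VK"
      using maps T carr
      by (auto simp: module_hom_def class_ring_simps module_vec_simps
        mult_add_distrib_mat_vec[OF T] mult_mat_vec[OF T])
  qed unfold_locales
  have ker: "T.kerT = mat_kernel (A @\<^sub>r T)"
    by (auto simp: T.ker_def mat_kernel_append_rows[OF A T] module_vec_simps)
  show ?thesis
    using T.dim_le_dim_plus_dim_ker[OF A.fin_dim_kernel B.fin_dim_kernel]
    by (simp add: ker)
qed

lemma kernel_dim_le_dim_col: "kernel_dim A \<le> dim_col A"
  by (simp add: kernel_dim_code)

lemma kernel_dim_trivial:
  fixes A :: "'a :: field mat"
  assumes "mat_kernel A \<subseteq> {0\<^sub>v (dim_col A)}"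
  shows "kernel_dim A = 0"
proof -
  interpret A: kernel "dim_row A" "dim_col A" A by unfold_locales auto
  have "A.dim \<le> card ({} :: 'a vec set)"
    using assms A.Ker.zero_closed by (intro A.Ker.gen_ge_dim) (auto simp: A.Ker.span_empty)
  then show ?thesis by simp
qed

text \<open>
  Imposing the \<open>k\<close> equations \<open>P v = 0\<close> lowers the dimension by at most \<open>k\<close>, and what remains
  embeds into the kernel of \<open>B\<close>. Both steps are instances of the previous estimate, for the maps
  \<open>P\<close> and \<open>T\<close>.
\<close>

lemma kernel_dim_le_add_constraints:
  fixes A :: "'a :: field mat"
  assumes A: "A \<in> carrier_mat nr nc" and B: "B \<in> carrier_mat mr m"
    and T: "T \<in> carrier_mat m nc" and P: "P \<in> carrier_mat k nc"
    and maps: "\<And>v. v \<in> mat_kernel A \<Longrightarrow> P *\<^sub>v v = 0\<^sub>v k \<Longrightarrow> T *\<^sub>v v \<in> mat_kernel B"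
    and inj: "\<And>v. v \<in> mat_kernel A \<Longrightarrow> P *\<^sub>v v = 0\<^sub>v k \<Longrightarrow> T *\<^sub>v v = 0\<^sub>v m \<Longrightarrow> v = 0\<^sub>v nc"
  shows "kernel_dim A \<le> kernel_dim B + k"
proof -
  have AP: "A @\<^sub>r P \<in> carrier_mat (nr + k) nc" using A P by simp
  \<comment> \<open>The matrix without rows has kernel \<open>'a^k\<close>, which makes it a target for \<open>P\<close>.\<close>
  have Z: "0\<^sub>m 0 k \<in> carrier_mat 0 k" by simp
  have "kernel_dim A \<le> kernel_dim (0\<^sub>m 0 k :: 'a mat) + kernel_dim (A @\<^sub>r P)"
  proof (rule kernel_dim_le_target_plus_common_kernel[OF A Z P])
    fix v assume "v \<in> mat_kernel A"
    then show "P *\<^sub>v v \<in> mat_kernel (0\<^sub>m 0 k)"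
      using P mat_kernelD(1)[OF A] by (intro mat_kernelI[OF Z]) auto
  qed
  moreover have "kernel_dim (A @\<^sub>r P) \<le> kernel_dim B + kernel_dim ((A @\<^sub>r P) @\<^sub>r T)"
    by (rule kernel_dim_le_target_plus_common_kernel[OF AP B T])
      (use maps in \<open>auto simp: mat_kernel_append_rows[OF A P]\<close>)
  moreover have "kernel_dim ((A @\<^sub>r P) @\<^sub>r T) = 0"
  proof (rule kernel_dim_trivial)
    show "mat_kernel ((A @\<^sub>r P) @\<^sub>r T) \<subseteq> {0\<^sub>v (dim_col ((A @\<^sub>r P) @\<^sub>r T))}"
      using inj AP T
      by (auto simp: mat_kernel_append_rows[OF AP T] mat_kernel_append_rows[OF A P]
        carrier_matD(2)[OF carrier_append_rows[OF AP T]])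
  qed
  moreover have "kernel_dim (0\<^sub>m 0 k :: 'a mat) \<le> k"
    using kernel_dim_le_dim_col[of "0\<^sub>m 0 k :: 'a mat"] by simp
  ultimately show ?thesis by linarith
qed

section \<open>Null functions of a graph\<close>

definition null_function :: "'a pair_pre_digraph \<Rightarrow> ('a \<Rightarrow> real) \<Rightarrow> bool" where
  "null_function G f \<longleftrightarrow> (\<forall>u \<in> pverts G. sum f (parcs G `` {u}) = 0)"

text \<open>
  Lists that miss or repeat vertices are allowed: restricting a function to some vertices, or
  pulling it back along a map of vertices, then becomes a passage from one list to another, which
  is multiplication by a 0-1 matrix.
\<close>

definition restriction_vec :: "'a list \<Rightarrow> ('a \<Rightarrow> real) \<Rightarrow> real vec" where
  "restriction_vec vs f = vec (length vs) (\<lambda>i. f (vs ! i))"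

lemma restriction_vec_carrier [simp]: "restriction_vec vs f \<in> carrier_vec (length vs)"
  by (simp add: restriction_vec_def)

lemma restriction_vec_eq_0_iff:
  "restriction_vec vs f = 0\<^sub>v (length vs) \<longleftrightarrow> (\<forall>v \<in> set vs. f v = 0)"
  by (simp add: restriction_vec_def vec_eq_iff all_set_conv_all_nth)

lemma restriction_vec_surj:
  assumes "distinct vs" and w: "w \<in> carrier_vec (length vs)"
  obtains f where "w = restriction_vec vs f"
proof
  show "w = restriction_vec vs (\<lambda>v. w $ (THE i. i < length vs \<and> vs ! i = v))"
  proof (rule eq_vecI)
    fix i assume "i < dim_vec (restriction_vec vs (\<lambda>v. w $ (THE i. i < length vs \<and> vs ! i = v)))"
    then have i: "i < length vs" by (simp add: restriction_vec_def)
    then have "(THE j. j < length vs \<and> vs ! j = vs ! i) = i"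
      using assms by (intro the_equality) (auto simp: nth_eq_iff_index_eq)
    then show "w $ i = restriction_vec vs (\<lambda>v. w $ (THE i. i < length vs \<and> vs ! i = v)) $ i"
      using i by (simp add: restriction_vec_def)
  qed (use w in \<open>simp add: restriction_vec_def\<close>)
qed

lemma mult_restriction_vec:
  assumes "distinct vs"
  shows "mat n (length vs) (\<lambda>(i, j). c i (vs ! j)) *\<^sub>v restriction_vec vs f =
    vec n (\<lambda>i. \<Sum>v \<in> set vs. c i v * f v)"
proof (rule eq_vecI)
  fix i assume "i < dim_vec (vec n (\<lambda>i. \<Sum>v \<in> set vs. c i v * f v))"
  then have i: "i < n" by simp
  have "(\<Sum>j = 0..<length vs. c i (vs ! j) * f (vs ! j)) = (\<Sum>v \<in> set vs. c i v * f v)"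
    using assms by (intro sum.reindex_bij_betw[of "\<lambda>j. vs ! j" _ _ "\<lambda>v. c i v * f v"]
      bij_betw_nth) auto
  then show "(mat n (length vs) (\<lambda>(i, j). c i (vs ! j)) *\<^sub>v restriction_vec vs f) $ i =
      vec n (\<lambda>i. \<Sum>v \<in> set vs. c i v * f v) $ i"
    using i by (simp add: scalar_prod_def restriction_vec_def)
qed simp

lemma restriction_vec_in_mat_kernel_iff:
  assumes G: "pair_graph G" and vs: "vertex_enum G vs"
  shows "restriction_vec vs f \<in> mat_kernel (adjacency_mat G vs) \<longleftrightarrow> null_function G f"
proof -
  interpret pair_graph G by fact
  have vs': "distinct vs" "set vs = pverts G" using vs by (auto simp: vertex_enum_def)
  have A: "adjacency_mat G vs \<in> carrier_mat (length vs) (length vs)"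
    by (simp add: adjacency_mat_def)
  have "(\<Sum>v \<in> set vs. (if (u, v) \<in> parcs G then 1 else 0) * f v) = sum f (parcs G `` {u})" for u
  proof -
    have "{v \<in> set vs. (u, v) \<in> parcs G} = parcs G `` {u}"
      using vs' in_arcsD2 by auto
    then show ?thesis
      by (simp add: if_distrib[of "\<lambda>c. c * _"] sum.If_cases Int_def cong: if_cong)
  qed
  then have "adjacency_mat G vs *\<^sub>v restriction_vec vs f =
      restriction_vec vs (\<lambda>u. sum f (parcs G `` {u}))"
    unfolding adjacency_mat_def
    using mult_restriction_vec[OF vs'(1), of "length vs"
        "\<lambda>i v. if (vs ! i, v) \<in> parcs G then 1 else 0" f]
    by (simp add: restriction_vec_def)
  then show ?thesis
    using vs' by (simp add: mat_kernel[OF A] null_function_def restriction_vec_eq_0_iff)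
qed

lemma selection_mat_mult_restriction_vec:
  assumes "distinct vs" and "set us \<subseteq> set vs"
  shows "mat (length us) (length vs) (\<lambda>(i, j). if vs ! j = us ! i then 1 else 0)
    *\<^sub>v restriction_vec vs f = restriction_vec us f"
proof -
  have "(\<Sum>v \<in> set vs. (if v = us ! i then 1 else 0) * f v) = f (us ! i)" if "i < length us" for i
  proof -
    have "us ! i \<in> set vs" using that assms(2) by auto
    then show ?thesis by (simp add: if_distrib[of "\<lambda>c. c * _"] cong: if_cong)
  qed
  then show ?thesis
    using mult_restriction_vec[OF assms(1), of "length us"
        "\<lambda>i v. if v = us ! i then 1 else 0" f]
    by (auto simp: restriction_vec_def intro!: eq_vecI)
qed

text \<open>
  A bound for the nullity that refers neither to enumerations nor to matrices: pulling back along
  \<open>e\<close> is injective on the null functions of \<open>G'\<close> that vanish on \<open>R\<close>, and produces null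
  functions of \<open>G\<close>.
\<close>

lemma nullity_le_add_card:
  assumes G: "pair_graph G" and G': "pair_graph G'"
    and e: "e ` pverts G \<subseteq> pverts G'" and R: "R \<subseteq> pverts G'"
    and null: "\<And>f. null_function G' f \<Longrightarrow> (\<forall>r \<in> R. f r = 0) \<Longrightarrow> null_function G (f \<circ> e)"
    and zero: "\<And>f. null_function G' f \<Longrightarrow> (\<forall>r \<in> R. f r = 0) \<Longrightarrow>
      (\<forall>v \<in> pverts G. f (e v) = 0) \<Longrightarrow> (\<forall>w \<in> pverts G'. f w = 0)"
  shows "nullity G' \<le> nullity G + card R"
proof -
  interpret G': pair_graph G' by fact
  obtain vs where vs: "vertex_enum G vs" using vertex_enum_exists[OF G] by blast
  obtain ws where ws: "vertex_enum G' ws" using vertex_enum_exists[OF G'] by blast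
  obtain rs where rs: "distinct rs" "set rs = R"
    using finite_distinct_list finite_subset[OF R G'.pair_finite_verts] by blast
  have ws': "distinct ws" "set ws = pverts G'" and vs': "set vs = pverts G"
    using ws vs by (auto simp: vertex_enum_def)
  define select where "select us =
    mat (length us) (length ws) (\<lambda>(i, j). if ws ! j = us ! i then 1 else 0 :: real)" for us
  let ?A = "adjacency_mat G' ws" and ?B = "adjacency_mat G vs"
  have A: "?A \<in> carrier_mat (length ws) (length ws)"
    and B: "?B \<in> carrier_mat (length vs) (length vs)"
    by (auto simp: adjacency_mat_def)
  have T: "select (map e vs) \<in> carrier_mat (length vs) (length ws)"
    and P: "select rs \<in> carrier_mat (length rs) (length ws)"
    by (auto simp: select_def)
  have T_mult: "select (map e vs) *\<^sub>v restriction_vec ws f = restriction_vec vs (f \<circ> e)" for f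
  proof -
    have "select (map e vs) *\<^sub>v restriction_vec ws f = restriction_vec (map e vs) f"
      unfolding select_def using e vs' ws'
      by (intro selection_mat_mult_restriction_vec) auto
    also have "\<dots> = restriction_vec vs (f \<circ> e)"
      by (rule eq_vecI) (auto simp: restriction_vec_def)
    finally show ?thesis .
  qed
  have P_mult: "select rs *\<^sub>v restriction_vec ws f = restriction_vec rs f" for f
    unfolding select_def
    using selection_mat_mult_restriction_vec[OF ws'(1), of rs f] R rs ws'(2) by simp
  have P_zero: "select rs *\<^sub>v restriction_vec ws f = 0\<^sub>v (length rs) \<longleftrightarrow> (\<forall>r \<in> R. f r = 0)" for f
    by (simp add: P_mult restriction_vec_eq_0_iff rs)
  note ker' = restriction_vec_in_mat_kernel_iff[OF G' ws]
  note ker = restriction_vec_in_mat_kernel_iff[OF G vs]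
  have "kernel_dim ?A \<le> kernel_dim ?B + length rs"
  proof (rule kernel_dim_le_add_constraints[OF A B T P])
    fix w assume w: "w \<in> mat_kernel ?A" "select rs *\<^sub>v w = 0\<^sub>v (length rs)"
    obtain f where f: "w = restriction_vec ws f"
      using restriction_vec_surj[OF ws'(1) mat_kernelD(1)[OF A w(1)]] .
    have f_null: "null_function G' f" "\<forall>r \<in> R. f r = 0"
      using w unfolding f P_zero by (auto simp: ker')
    show "select (map e vs) *\<^sub>v w \<in> mat_kernel ?B"
      using null[OF f_null] by (simp add: f T_mult ker)
    show "w = 0\<^sub>v (length ws)" if "select (map e vs) *\<^sub>v w = 0\<^sub>v (length vs)"
      using zero[OF f_null] that
      by (simp add: f T_mult restriction_vec_eq_0_iff vs' ws'(2))
  qed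
  then show ?thesis
    using rs by (simp add: nullity_eq[OF vs] nullity_eq[OF ws] distinct_card[symmetric])
qed

section \<open>Null functions of an altan\<close>

text \<open>
  Walking once around the cycle multiplies the initial value by \<open>(-1)^h\<close>, so for odd \<open>h\<close> this
  value equals its own negative.
\<close>

lemma alternating_cycle_eq_0:
  fixes a :: "nat \<Rightarrow> real"
  assumes step: "\<And>i. i < h \<Longrightarrow> a (Suc i mod h) = - a i"
    and start: "odd h \<or> a 0 = 0"
    and "i < h"
  shows "a i = 0"
proof -
  have alt: "a j = (- 1) ^ j * a 0" if "j < h" for j
    using that
  proof (induction j)
    case (Suc j)
    then show ?case using step[of j] by simp
  qed simp
  have "a 0 = 0"
  proof (cases "odd h")
    case True
    then obtain k where k: "h = Suc (2 * k)" by (auto elim: oddE)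
    then have "a 0 = - a 0"
      using step[of "2 * k"] alt[of "2 * k"] by simp
    then show ?thesis by simp
  qed (use start in simp)
  then show ?thesis using alt[OF \<open>i < h\<close>] by simp
qed

lemma pverts_altan:
  "pverts (fst (altan G H)) = Base ` pverts G \<union> X ` {..<length H} \<union> Y ` {..<length H}"
  by (simp add: altan_def)

lemma neighbours_altan_Base:
  "parcs (fst (altan G H)) `` {Base v} =
    Base ` (parcs G `` {v}) \<union> X ` {i. i < length H \<and> H ! i = v}"
  by (auto simp: altan_def altan_new_edges_def)

text \<open>
  The vertex is written as a cyclic successor since the two \<open>Y\<close>-neighbours of \<open>X j\<close> are \<open>Y j\<close>
  and \<open>Y\<close> at the cyclic predecessor of \<open>j\<close>; this avoids computing predecessors modulo the length.
\<close>

lemma neighbours_altan_X: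
  assumes "i < length H"
  shows "parcs (fst (altan G H)) `` {X (Suc i mod length H)} =
    {Base (H ! (Suc i mod length H)), Y (Suc i mod length H), Y i}"
proof -
  have inj: "j = i" if "j < length H" "Suc j mod length H = Suc i mod length H" for j
    using that assms by (auto simp: mod_Suc split: if_splits)
  have "Suc i mod length H < length H"
    using assms by (intro mod_less_divisor) auto
  then show ?thesis
    using assms by (auto simp: altan_def altan_new_edges_def dest: inj)
qed

lemma neighbours_altan_Y:
  assumes "i < length H"
  shows "parcs (fst (altan G H)) `` {Y i} = {X i, X (Suc i mod length H)}"
  using assms by (auto simp: altan_def altan_new_edges_def)

text \<open>
  This is where the length of the tuple matters: the two neighbours of a \<open>Y\<close>-vertex, and the two
  \<open>Y\<close>-neighbours of an \<open>X\<close>-vertex, are distinct, so a sum over the neighbourhood counts both.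
\<close>

lemma Suc_mod_neq: "2 \<le> h \<Longrightarrow> i < h \<Longrightarrow> Suc i mod h \<noteq> i"
  by (auto simp: mod_Suc)

lemma null_function_altan_X_alternates:
  assumes f: "null_function (fst (altan G H)) f" and h: "2 \<le> length H" and i: "i < length H"
  shows "f (X (Suc i mod length H)) = - f (X i)"
proof -
  have "sum f (parcs (fst (altan G H)) `` {Y i}) = 0"
    using f i by (auto simp: null_function_def pverts_altan)
  then show ?thesis
    using Suc_mod_neq[OF h i] by (auto simp: neighbours_altan_Y[OF i])
qed

lemma null_function_altan_at_X:
  assumes f: "null_function (fst (altan G H)) f" and h: "2 \<le> length H" and i: "i < length H"
  shows "f (Base (H ! (Suc i mod length H))) + f (Y (Suc i mod length H)) + f (Y i) = 0"
proof -
  have "Suc i mod length H < length H"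
    using i by (intro mod_less_divisor) auto
  then have "sum f (parcs (fst (altan G H)) `` {X (Suc i mod length H)}) = 0"
    using f by (simp add: null_function_def pverts_altan)
  then show ?thesis
    using Suc_mod_neq[OF h i] by (auto simp: neighbours_altan_X[OF i])
qed

lemma null_function_altan_Base:
  assumes G: "pair_graph G" and f: "null_function (fst (altan G H)) f"
    and X: "\<And>i. i < length H \<Longrightarrow> f (X i) = 0"
  shows "null_function G (f \<circ> Base)"
  unfolding null_function_def
proof
  interpret pair_graph G by fact
  fix v assume v: "v \<in> pverts G"
  have "finite (parcs G `` {v})"
    using pair_finite_arcs by (rule finite_Image)
  then have "sum f (parcs (fst (altan G H)) `` {Base v}) =
      sum f (Base ` (parcs G `` {v})) + sum f (X ` {i. i < length H \<and> H ! i = v})"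
    unfolding neighbours_altan_Base by (intro sum.union_disjoint) auto
  also have "sum f (X ` {i. i < length H \<and> H ! i = v}) = 0"
    using X by (intro sum.neutral) auto
  also have "sum f (Base ` (parcs G `` {v})) = sum (f \<circ> Base) (parcs G `` {v})"
    by (rule sum.reindex) (simp add: inj_on_def)
  finally show "sum (f \<circ> Base) (parcs G `` {v}) = 0"
    using f v by (simp add: null_function_def pverts_altan)
qed

theorem theorem7:
  fixes G :: "'a pair_pre_digraph" and H :: "'a list"
  assumes "pair_graph G"
    and "attachment_set G H"
  shows "nullity (fst (altan G H)) \<le>
    (if even (length H) then nullity G + 2 else nullity G)"
proof -
  let ?G' = "fst (altan G H)"
  define R :: "'a altan_vertex set" where "R = (if even (length H) then {X 0, Y 0} else {})"
  have H: "set H \<subseteq> pverts G" and h: "2 \<le> length H"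
    using assms(2) by (auto simp: attachment_set_def)
  have start: "odd (length H) \<or> f (X 0) = 0" "odd (length H) \<or> f (Y 0) = 0"
    if "\<forall>r \<in> R. f r = 0" for f :: "'a altan_vertex \<Rightarrow> real"
    using that by (auto simp: R_def split: if_splits)
  have X: "f (X i) = 0"
    if "null_function ?G' f" "\<forall>r \<in> R. f r = 0" "i < length H" for f i
    using null_function_altan_X_alternates[OF that(1) h] start(1)[OF that(2)] that(3)
    by (rule alternating_cycle_eq_0[where a = "\<lambda>i. f (X i)"])
  have Y: "f (Y i) = 0"
    if "null_function ?G' f" "\<forall>r \<in> R. f r = 0" "\<forall>v \<in> pverts G. f (Base v) = 0" "i < length H"
    for f i
  proof (rule alternating_cycle_eq_0[where a = "\<lambda>i. f (Y i)"])
    fix j assume j: "j < length H"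
    have "H ! (Suc j mod length H) \<in> pverts G"
      using H h by (intro subsetD[OF H] nth_mem mod_less_divisor) auto
    then show "f (Y (Suc j mod length H)) = - f (Y j)"
      using null_function_altan_at_X[OF that(1) h j] that(3) by simp
  qed (use start(2)[OF that(2)] that(4) in auto)
  have "nullity ?G' \<le> nullity G + card R"
  proof (rule nullity_le_add_card[OF assms(1) pair_graph_altan[OF assms], where e = Base])
    show "Base ` pverts G \<subseteq> pverts ?G'" by (auto simp: pverts_altan)
    show "R \<subseteq> pverts ?G'" using h by (auto simp: R_def pverts_altan)
  qed (use X Y null_function_altan_Base[OF assms(1)] in \<open>auto simp: pverts_altan\<close>)
  then show ?thesis by (auto simp: R_def split: if_splits)
qed

end
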